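(* Let $T$ be a tree of order $n$. Then $\mathcal{C}(T)=n$ if and only if $T$ is a path of order at most $4$.
   Context: For a graph $G$ with vertex set $V$, a set $S\subseteq V$ is a dominating set if every vertex of $V\setminus S$ is adjacent to a vertex of $S$. Two disjoint sets $V_1,V_2\subseteq V$ form a coalition in $G$ if neither is a dominating set of $G$ but $V_1\cup V_2$ is. A coalition partition of $G$ is a partition $\Psi=\{V_1,\ldots,V_k\}$ of $V$ such that every $V_i\in\Psi$ is either a dominating set of $G$ with $|V_i|=1$, or is not a dominating set and forms a coalition with some $V_j\in\Psi$. The coalition number $\mathcal{C}(G)$ is the maximum cardinality of a coalition partition of $G$. The order is $n=|V|$. *)

theory Defs
  imports "Graph_Theory.Digraph_Component" "HOL-Library.Disjoint_Sets"
begin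

text \<open>
  A finite simple undirected graph is a \<open>pair_graph\<close>: each edge is stored as its two
  orientations, and the arc relation is symmetric and irreflexive.
\<close>

definition dominating_set :: "'a pair_pre_digraph \<Rightarrow> 'a set \<Rightarrow> bool" where
  "dominating_set G S \<longleftrightarrow>
     S \<subseteq> pverts G \<and> (\<forall>v \<in> pverts G - S. \<exists>u \<in> S. (u, v) \<in> parcs G)"

definition coalition :: "'a pair_pre_digraph \<Rightarrow> 'a set \<Rightarrow> 'a set \<Rightarrow> bool" where
  "coalition G A B \<longleftrightarrow>
     A \<subseteq> pverts G \<and> B \<subseteq> pverts G \<and> A \<inter> B = {} \<and>
     \<not> dominating_set G A \<and> \<not> dominating_set G B \<and> dominating_set G (A \<union> B)"

definition coalition_partition :: "'a pair_pre_digraph \<Rightarrow> 'a set set \<Rightarrow> bool" where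
  "coalition_partition G P \<longleftrightarrow>
     partition_on (pverts G) P \<and>
     (\<forall>A \<in> P. (dominating_set G A \<and> card A = 1) \<or>
              (\<not> dominating_set G A \<and> (\<exists>B \<in> P. coalition G A B)))"

text \<open>
  On a finite graph the supremum is over a finite set of naturals, hence a maximum as soon as a
  coalition partition exists (\<open>coalition_number_attained\<close>); \<open>Max\<close> would be
  unspecified on the empty set, where \<open>Sup\<close> is 0.
\<close>

definition coalition_number :: "'a pair_pre_digraph \<Rightarrow> nat" where
  "coalition_number G = Sup {card P | P. coalition_partition G P}"

text \<open>
  The library's \<open>tree\<close> is unsuitable here: in a symmetric digraph the two orientations of an
  edge form a directed cycle of length 2. Directed cycles of length at least 3 correspond
  to the undirected cycles.
\<close>

definition undirected_tree :: "'a pair_pre_digraph \<Rightarrow> bool" where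
  "undirected_tree G \<longleftrightarrow>
     pair_graph G \<and> connected (with_proj G) \<and>
     \<not> (\<exists>p. pre_digraph.cycle (with_proj G) p \<and> 3 \<le> length p)"

definition path_graph :: "'a pair_pre_digraph \<Rightarrow> bool" where
  "path_graph G \<longleftrightarrow>
     (\<exists>vs. vs \<noteq> [] \<and> distinct vs \<and> pverts G = set vs \<and>
       parcs G = {(x, y). \<exists>i. Suc i < length vs \<and> {x, y} = {vs ! i, vs ! Suc i}})"

lemma finite_coalition_partition_cards:
  assumes "finite (pverts G)"
  shows "finite {card P | P. coalition_partition G P}"
proof -
  have "{P. coalition_partition G P} \<subseteq> Pow (Pow (pverts G))"
    by (auto simp: coalition_partition_def partition_on_def)
  then have "finite {P. coalition_partition G P}"
    using assms by (meson finite_Pow_iff finite_subset)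
  then show ?thesis by simp
qed

lemma coalition_number_attained:
  assumes "finite (pverts G)" and "coalition_partition G Q"
  shows "\<exists>P. coalition_partition G P \<and> card P = coalition_number G"
    and "card Q \<le> coalition_number G"
proof -
  let ?X = "{card P | P. coalition_partition G P}"
  have fin: "finite ?X" using assms(1) by (rule finite_coalition_partition_cards)
  have Q: "card Q \<in> ?X" using assms(2) by blast
  have eq: "coalition_number G = Max ?X"
    unfolding coalition_number_def using fin Q by (intro cSup_eq_Max) auto
  have "Max ?X \<in> ?X" using fin Q by (intro Max_in) auto
  then show "\<exists>P. coalition_partition G P \<and> card P = coalition_number G"
    unfolding eq by auto
  show "card Q \<le> coalition_number G" unfolding eq using fin Q by (rule Max_ge)
qed

end

theory Submission
  imports Defs "Graph_Theory.Vertex_Walk"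
begin

text \<open>
  A partition into \<open>n\<close> blocks is the partition into singletons, so the question is when every
  vertex is dominating or forms a coalition with another vertex. A dominating vertex forces
  \<open>n \<le> 3\<close>, since two leaves of a star do not dominate a third one. Otherwise let \<open>x\<close> be a
  leaf with neighbour \<open>y\<close> and partner \<open>w\<close>. All vertices besides \<open>x\<close>, \<open>y\<close>, \<open>w\<close> are
  neighbours of \<open>w\<close>, hence pairwise non-adjacent, and at most one of \<open>w\<close> and these vertices is
  adjacent to \<open>y\<close>. If \<open>y\<close> is adjacent to \<open>w\<close> and \<open>n \<ge> 5\<close>, a leaf at \<open>w\<close> has no
  partner; if \<open>y\<close> is adjacent to a neighbour \<open>z\<close> of \<open>w\<close> and \<open>n \<ge> 5\<close>, then \<open>z\<close> has none.
\<close>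

section \<open>The partition into singletons\<close>

lemma partition_on_card_le:
  assumes "finite A" and "partition_on A P"
  shows "card P \<le> card A"
proof -
  have fin: "finite P" "\<And>p. p \<in> P \<Longrightarrow> finite p"
    using assms by (auto simp: finite_elements dest: partition_onD1 intro: finite_subset)
  have "card P = (\<Sum>p\<in>P. 1)" by simp
  also have "\<dots> \<le> (\<Sum>p\<in>P. card p)"
    using assms(2) fin by (intro sum_mono) (metis One_nat_def Suc_leI card_gt_0_iff partition_onD3)
  also have "\<dots> = card A"
    using assms(2) fin by (metis card_Union_disjoint partition_onD1 partition_onD2)
  finally show ?thesis .
qed

text \<open>The block sizes sum to \<open>card A\<close> and each is at least 1, so equality in the
  bound above forces every size to be exactly 1.\<close>

lemma partition_on_card_eq_imp_singletons:
  assumes "finite A" and "partition_on A P" and "card P = card A"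
  shows "P = (\<lambda>x. {x}) ` A"
proof -
  have fin: "finite P" "\<And>p. p \<in> P \<Longrightarrow> finite p"
    using assms by (auto simp: finite_elements dest: partition_onD1 intro: finite_subset)
  have ge: "1 \<le> card p" if "p \<in> P" for p
    using that assms(2) fin by (metis One_nat_def Suc_leI card_gt_0_iff partition_onD3)
  have "(\<Sum>p\<in>P. card p) = (\<Sum>p\<in>P. 1)"
    using assms(2,3) fin by (metis card_Union_disjoint card_eq_sum partition_onD1 partition_onD2)
  then have one: "card p = 1" if "p \<in> P" for p
    using sum_mono_inv[of "\<lambda>_. 1" P card] ge fin that by fastforce
  have A: "A = \<Union>P" using assms(2) by (rule partition_onD1)
  show ?thesis
  proof
    show "P \<subseteq> (\<lambda>x. {x}) ` A"
      using one A by (fastforce simp: card_1_singleton_iff)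
    show "(\<lambda>x. {x}) ` A \<subseteq> P"
    proof
      fix s assume "s \<in> (\<lambda>x. {x}) ` A"
      then obtain x p where "s = {x}" "x \<in> p" "p \<in> P" using A by auto
      then show "s \<in> P" using one[of p] by (auto simp: card_1_singleton_iff)
    qed
  qed
qed

text \<open>The order bounds the size of every coalition partition, and \<open>?S\<close> is the
  only partition of that size. Hence the maximum equals the order exactly when \<open>?S\<close> is
  itself a coalition partition, which is \<open>?R\<close>.\<close>

lemma coalition_number_eq_card_iff:
  assumes "finite (pverts G)" and "pverts G \<noteq> {}"
  shows "coalition_number G = card (pverts G) \<longleftrightarrow>
    (\<forall>v \<in> pverts G. dominating_set G {v} \<or> (\<exists>w \<in> pverts G. coalition G {v} {w}))"
    (is "_ \<longleftrightarrow> ?R")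
proof -
  let ?S = "(\<lambda>x. {x}) ` pverts G"
  have card_S: "card ?S = card (pverts G)" by (simp add: card_image)
  have "partition_on (pverts G) ?S"
    by (auto simp: partition_on_def disjoint_def)
  then have S: "coalition_partition G ?S \<longleftrightarrow> ?R"
    by (auto simp: coalition_partition_def coalition_def)
  have le: "card P \<le> card (pverts G)" if "coalition_partition G P" for P
    using that partition_on_card_le assms(1) by (auto simp: coalition_partition_def)
  show ?thesis
  proof
    assume eq: "coalition_number G = card (pverts G)"
    have "\<exists>Q. coalition_partition G Q"
    proof (rule ccontr)
      assume "\<not> ?thesis"
      \<comment> \<open>Here \<open>Sup\<close> is taken over the empty set of naturals and is 0,
        while the order is positive.\<close>
      then have "coalition_number G = 0" by (simp add: coalition_number_def)
      then show False using eq assms by simp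
    qed
    then obtain P where P: "coalition_partition G P" "card P = card (pverts G)"
      using coalition_number_attained(1)[OF assms(1)] eq by metis
    then have "P = ?S"
      using partition_on_card_eq_imp_singletons assms(1) by (auto simp: coalition_partition_def)
    then show ?R using P S by simp
  next
    assume ?R
    then have Q: "coalition_partition G ?S" using S by simp
    then obtain P where "coalition_partition G P" "card P = coalition_number G"
      using coalition_number_attained(1)[OF assms(1)] by metis
    then have "coalition_number G \<le> card (pverts G)" using le by metis
    then show "coalition_number G = card (pverts G)"
      using coalition_number_attained(2)[OF assms(1) Q] card_S by simp
  qed
qed

lemma coalition_singletons_iff:
  "coalition G {v} {w} \<longleftrightarrow> v \<noteq> w \<and> \<not> dominating_set G {v} \<and> \<not> dominating_set G {w} \<and>
     dominating_set G {v, w}"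
  by (auto simp: coalition_def dominating_set_def)

lemma coalition_sym: "coalition G A B \<Longrightarrow> coalition G B A"
  by (auto simp: coalition_def Un_commute)

section \<open>Trees\<close>

locale undirected_tree_graph = pair_graph T for T :: "'a pair_pre_digraph" +
  assumes connected: "connected (with_proj T)"
    and acyclic: "\<not> (\<exists>p. cycle p \<and> 3 \<le> length p)"
begin

abbreviation adjacent :: "'a \<Rightarrow> 'a \<Rightarrow> bool" (infix "\<sim>" 50) where
  "u \<sim> v \<equiv> (u, v) \<in> parcs T"

lemma adjacent_sym: "u \<sim> v \<Longrightarrow> v \<sim> u"
  by (rule arcs_symmetric)

lemma not_adjacent_self [simp]: "\<not> v \<sim> v"
  using no_loops by fastforce

lemma verts_nonempty: "pverts T \<noteq> {}"
  using connected by (auto simp: connected_def strongly_connected_def mk_symmetric_def)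

text \<open>If no edge left \<open>S\<close>, induction along a walk from a vertex of
  \<open>S\<close> would keep every reachable vertex inside \<open>S\<close>.\<close>

lemma ex_adjacent_across:
  assumes "S \<subseteq> pverts T" "S \<noteq> {}" "S \<noteq> pverts T"
  obtains u v where "u \<in> S" "v \<in> pverts T" "v \<notin> S" "u \<sim> v"
proof -
  obtain a b where ab: "a \<in> S" "b \<in> pverts T" "b \<notin> S" using assms by auto
  have "strongly_connected (with_proj (mk_symmetric (with_proj T)))"
    using connected by (simp add: connected_def)
  then have "a \<rightarrow>\<^sup>*\<^bsub>with_proj (mk_symmetric (with_proj T))\<^esub> b"
    using ab assms(1) by (auto simp: strongly_connected_def mk_symmetric_def)
  then have "a \<rightarrow>\<^sup>*\<^bsub>with_proj T\<^esub> b" using reachable_mk_symmetric_eq sym_arcs by blast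
  moreover have "b \<in> S" if "\<And>u v. u \<in> S \<Longrightarrow> u \<sim> v \<Longrightarrow> v \<in> S"
    using \<open>a \<rightarrow>\<^sup>*\<^bsub>with_proj T\<^esub> b\<close> by (induct rule: reachable_induct) (auto simp: ab(1) that)
  ultimately show thesis using ab that wellformed' by blast
qed

text \<open>Translates acyclicity from arc walks to lists of vertices. The bound on
  \<open>vs\<close> makes the closed walk at least 3 long, so that it is more than one edge run back
  and forth.\<close>

lemma not_cycle:
  assumes "vpath (u # vs) T" "2 \<le> length vs" "last vs \<sim> u"
  shows False
proof -
  have verts: "pawalk_verts x (vwalk_arcs (x # xs)) = x # xs" for x :: 'a and xs
    by (induct xs arbitrary: x) auto
  have cas: "pcas x (vwalk_arcs (x # xs)) (last (x # xs))" for x :: 'a and xs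
    by (induct xs arbitrary: x) auto
  let ?p = "vwalk_arcs (u # vs @ [u])"
  have vs: "vs \<noteq> []" using assms(2) by auto
  then have "?p = vwalk_arcs (u # vs) @ [(last vs, u)]"
    using vwalk_arcs_append[of "u # vs" "[u]"] by simp
  then have arcs: "set ?p \<subseteq> parcs T"
    using assms by (auto simp: vpath_def vwalk_def)
  have len: "length ?p = length vs + 1"
    using vwalk_length_simp[of "u # vs @ [u]"] unfolding vwalk_length_def
    by (simp del: vwalk_arcs_Cons)
  have "awalk u ?p u"
    using arcs cas[of u "vs @ [u]"] assms(1) by (auto simp: awalk_def vpath_def vwalk_def)
  moreover have "distinct (tl (awalk_verts u ?p))"
    using verts[of u "vs @ [u]"] assms(1) by (auto simp: vpath_def)
  moreover have "?p \<noteq> []" using len by auto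
  ultimately have "cycle ?p" unfolding cycle_def by blast
  then show False using acyclic len assms(2) by auto
qed

lemma no_triangle:
  assumes "a \<sim> b" "b \<sim> c" shows "\<not> a \<sim> c"
proof
  assume "a \<sim> c"
  moreover have "a \<noteq> b" "b \<noteq> c" "a \<noteq> c" using assms \<open>a \<sim> c\<close> by auto
  ultimately show False
    using not_cycle[of a "[b, c]"] assms wellformed' adjacent_sym by (auto simp: vpath_def vwalk_def)
qed

text \<open>Phrased as uniqueness of a common neighbour of \<open>a\<close> and \<open>c\<close>,
  the form in which it is applied later.\<close>

lemma no_square:
  assumes "a \<sim> b" "b \<sim> c" "c \<sim> d" "d \<sim> a" "a \<noteq> c" shows "b = d"
proof (rule ccontr)
  assume "b \<noteq> d"
  moreover have "a \<noteq> b" "b \<noteq> c" "c \<noteq> d" "a \<noteq> d" using assms by auto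
  ultimately show False
    using not_cycle[of a "[b, c, d]"] assms wellformed' by (auto simp: vpath_def vwalk_def)
qed

text \<open>The end of a path of maximal length is a leaf.\<close>

lemma ex_leaf:
  assumes "2 \<le> card (pverts T)"
  shows "\<exists>x y. \<forall>z. x \<sim> z \<longleftrightarrow> z = y"
proof -
  let ?P = "{p. vpath p T}"
  obtain a where a: "a \<in> pverts T" using verts_nonempty by blast
  have "{a} \<noteq> pverts T" using assms by (metis card.empty card.insert empty_iff finite.emptyI
        Suc_1 One_nat_def not_less_eq_eq le_refl)
  then obtain b where "a \<sim> b" using ex_adjacent_across[of "{a}"] a by auto
  then have ab: "vpath [a, b] T" "a \<noteq> b"
    using wellformed' by (auto simp: vpath_def vwalk_def)
  have "finite ?P" using vpaths_finite by simp
  then have fin: "finite (length ` ?P)" by simp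
  have "Max (length ` ?P) \<in> length ` ?P" using fin ab by (intro Max_in) auto
  then obtain p where p: "vpath p T" and "length p = Max (length ` ?P)" by auto
  then have max: "length q \<le> length p" if "vpath q T" for q
    using fin that by simp
  obtain x y r where xyr: "p = x # y # r"
    using max[OF ab(1)] by (metis Suc_le_length_iff length_Cons)
  have "x \<sim> y" using p xyr by (auto simp: vpath_def vwalk_def)
  moreover have "z = y" if "x \<sim> z" for z
  proof (rule ccontr)
    assume "z \<noteq> y"
    have "z \<in> set p"
    proof (rule ccontr)
      assume "z \<notin> set p"
      then have "vpath (z # p) T"
        using p xyr that adjacent_sym wellformed' by (auto simp: vpath_def vwalk_def)
      then show False using max[of "z # p"] by simp
    qed
    moreover have "z \<noteq> x" using that by auto
    ultimately have "z \<in> set r" using \<open>z \<noteq> y\<close> xyr by simp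
    then obtain r1 r2 where r: "r = r1 @ z # r2" by (meson split_list)
    \<comment> \<open>The initial segment of \<open>p\<close> ending in \<open>z\<close> closes to a
      cycle through the edge from \<open>z\<close> to \<open>x\<close>.\<close>
    have "vwalk ((x # y # r1 @ [z]) @ r2) T" using p xyr r by (auto simp: vpath_def)
    then have "vwalk (x # y # r1 @ [z]) T"
      using vwalkI_append_l[of "x # y # r1 @ [z]" r2]
      by (simp del: vwalk_Cons_Cons)
    then have "vpath (x # y # r1 @ [z]) T" using p xyr r by (auto simp: vpath_def)
    then show False using not_cycle[of x "y # r1 @ [z]"] adjacent_sym[OF that] by simp
  qed
  ultimately show ?thesis by blast
qed

section \<open>Domination by one or two vertices; recognising short paths\<close>

lemma dominating_set_pair_iff:
  "dominating_set T {v, w} \<longleftrightarrow> v \<in> pverts T \<and> w \<in> pverts T \<and>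
     (\<forall>u \<in> pverts T. u = v \<or> u = w \<or> v \<sim> u \<or> w \<sim> u)"
  by (auto simp: dominating_set_def)

lemma dominating_set_singleton_iff:
  "dominating_set T {v} \<longleftrightarrow> v \<in> pverts T \<and> (\<forall>u \<in> pverts T. u = v \<or> v \<sim> u)"
  by (auto simp: dominating_set_def)

text \<open>By symmetry and irreflexivity only index pairs with \<open>i < j\<close> have to be
  checked; for an explicit list this is a finite case split.\<close>

lemma path_graphI:
  assumes "vs \<noteq> []" "distinct vs" "pverts T = set vs"
    and adj: "\<And>i j. i < j \<Longrightarrow> j < length vs \<Longrightarrow> vs ! i \<sim> vs ! j \<longleftrightarrow> j = Suc i"
  shows "path_graph T"
proof -
  have "(x \<sim> y) \<longleftrightarrow> (\<exists>i. Suc i < length vs \<and> {x, y} = {vs ! i, vs ! Suc i})" for x y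
  proof
    assume "x \<sim> y"
    then have "x \<in> set vs" "y \<in> set vs" using wellformed' assms(3) by auto
    then obtain i j where ij: "x = vs ! i" "y = vs ! j" "i < length vs" "j < length vs"
      by (auto simp: in_set_conv_nth)
    show "\<exists>i. Suc i < length vs \<and> {x, y} = {vs ! i, vs ! Suc i}"
    proof (cases i j rule: linorder_cases)
      case less
      then show ?thesis using adj ij \<open>x \<sim> y\<close> by blast
    next
      case equal
      then show ?thesis using ij \<open>x \<sim> y\<close> by simp
    next
      case greater
      then show ?thesis using adj[of j i] ij adjacent_sym[OF \<open>x \<sim> y\<close>] by blast
    qed
  next
    assume "\<exists>i. Suc i < length vs \<and> {x, y} = {vs ! i, vs ! Suc i}"
    then show "x \<sim> y" using adj adjacent_sym by (metis doubleton_eq_iff lessI)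
  qed
  then show ?thesis
    unfolding path_graph_def using assms(1-3) by (intro exI[of _ vs]) auto
qed

text \<open>Take a leaf \<open>x\<close> with neighbour \<open>y\<close>. By connectedness a third
  vertex is attached to \<open>{x, y}\<close>, and it can only be attached to
  \<open>y\<close>.\<close>

lemma card_le_3_imp_path_graph:
  assumes "card (pverts T) \<le> 3"
  shows "path_graph T"
proof (cases "card (pverts T) \<le> 1")
  case True
  then have "card (pverts T) = 1"
    using verts_nonempty finite_verts by (simp add: le_Suc_eq)
  then obtain a where "pverts T = {a}" by (auto simp: card_1_singleton_iff)
  then show ?thesis by (intro path_graphI[of "[a]"]) auto
next
  case False
  then have "2 \<le> card (pverts T)" by simp
  then obtain x y where leaf: "\<And>z. x \<sim> z \<longleftrightarrow> z = y" using ex_leaf by blast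
  then have "x \<sim> y" by blast
  then have xy: "x \<noteq> y" "x \<in> pverts T" "y \<in> pverts T" using wellformed' by auto
  show ?thesis
  proof (cases "pverts T = {x, y}")
    case True
    then show ?thesis using leaf xy by (intro path_graphI[of "[x, y]"]) (auto simp: less_Suc_eq)
  next
    case False
    obtain u z where uz: "u \<in> {x, y}" "z \<in> pverts T" "z \<notin> {x, y}" "u \<sim> z"
      using ex_adjacent_across[of "{x, y}"] False xy by auto
    then have "y \<sim> z" "\<not> x \<sim> z" using leaf by auto
    have "{x, y, z} = pverts T"
      using uz xy assms finite_verts by (intro card_seteq) auto
    then show ?thesis using leaf uz xy \<open>y \<sim> z\<close> \<open>\<not> x \<sim> z\<close>
      by (intro path_graphI[of "[x, y, z]"]) (auto simp: less_Suc_eq)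
  qed
qed

section \<open>From coalitions to short paths\<close>

lemma dominating_vertex_imp_card_le_3:
  assumes dom: "dominating_set T {v}"
    and R: "\<forall>u \<in> pverts T. dominating_set T {u} \<or> (\<exists>w \<in> pverts T. coalition T {u} {w})"
  shows "card (pverts T) \<le> 3"
proof (rule ccontr)
  assume big: "\<not> ?thesis"
  have v: "v \<sim> u" if "u \<in> pverts T" "u \<noteq> v" for u
    using dom that by (auto simp: dominating_set_singleton_iff)
  have third: "\<exists>z \<in> pverts T. z \<notin> {a, b, c}" for a b c
  proof (rule ccontr)
    assume "\<not> ?thesis"
    then have "card (pverts T) \<le> card {a, b, c}" by (intro card_mono) auto
    also have "\<dots> \<le> 3" by (simp add: card_insert_if)
    finally show False using big by simp
  qed
  have leaf_pair: "\<not> a \<sim> b" if "a \<in> pverts T" "b \<in> pverts T" "a \<noteq> v" "b \<noteq> v" for a b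
    using no_triangle[of v a b] v that by blast
  obtain x where x: "x \<in> pverts T" "x \<noteq> v" using third[of v v v] by auto
  obtain z where z: "z \<in> pverts T" "z \<noteq> x" "z \<noteq> v" using third[of x v v] by auto
  have "\<not> dominating_set T {x}"
    using leaf_pair x z by (auto simp: dominating_set_singleton_iff)
  then obtain w where "coalition T {x} {w}" using R x by auto
  \<comment> \<open>The members of a coalition are not dominating, which rules out the centre
    \<open>v\<close> as a partner.\<close>
  then have w: "w \<noteq> v" "dominating_set T {x, w}" using dom by (auto simp: coalition_singletons_iff)
  obtain t where "t \<in> pverts T" "t \<notin> {x, v, w}" using third by blast
  then show False using leaf_pair w x by (auto simp: dominating_set_pair_iff)
qed

text \<open>When no single vertex dominates, two vertices form a coalition as soon as they dominate
  together, so \<open>R\<close> speaks of dominating pairs only.\<close>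

lemma all_coalitions_imp_path_graph:
  assumes nodom: "\<forall>v. \<not> dominating_set T {v}"
    and R: "\<forall>v \<in> pverts T. \<exists>w. dominating_set T {v, w}"
    and big: "4 \<le> card (pverts T)"
  shows "path_graph T \<and> card (pverts T) \<le> 4"
proof -
  have "2 \<le> card (pverts T)" using big by simp
  then obtain x y where leaf: "\<And>z. x \<sim> z \<longleftrightarrow> z = y" using ex_leaf by blast
  then have "x \<sim> y" by blast
  then have xy: "x \<noteq> y" "x \<in> pverts T" "y \<in> pverts T" using wellformed' by auto
  have leaf': "z \<sim> x \<longleftrightarrow> z = y" for z using leaf adjacent_sym by blast
  obtain w where w: "dominating_set T {x, w}" using R xy by auto
  have wV: "w \<in> pverts T" using w by (simp add: dominating_set_pair_iff)
  have wx: "w \<noteq> x" using w nodom by auto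
  \<comment> \<open>The leaf \<open>x\<close> dominates only \<open>x\<close> and \<open>y\<close>,
    both of which \<open>y\<close> dominates; if \<open>{x, y}\<close> dominated, so would
    \<open>{y}\<close>.\<close>
  have wy: "w \<noteq> y"
  proof
    assume "w = y"
    then have "dominating_set T {y}"
      using w leaf leaf' by (auto simp: dominating_set_pair_iff dominating_set_singleton_iff)
    then show False using nodom by blast
  qed
  have wadj: "w \<sim> u" if "u \<in> pverts T" "u \<notin> {x, y, w}" for u
    using w that leaf by (auto simp: dominating_set_pair_iff)
  have indep: "\<not> a \<sim> b" if "a \<in> pverts T" "b \<in> pverts T" "a \<notin> {x, y, w}" "b \<notin> {x, y, w}" for a b
    using no_triangle[of w a b] wadj that by blast
  have card4: "card {x, y, w, u} = 4" if "u \<notin> {x, y, w}" for u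
    using that xy wx wy by auto
  have all: "pverts T = {x, y, w, l}"
    if "l \<in> pverts T" "l \<notin> {x, y, w}" "\<And>m. m \<in> pverts T \<Longrightarrow> m \<notin> {x, y, w, l} \<Longrightarrow> False" for l
    using that xy wV by blast
  have "\<exists>l \<in> pverts T. l \<notin> {x, y, w}"
  proof (rule ccontr)
    assume "\<not> ?thesis"
    then have "card (pverts T) \<le> card {x, y, w}" by (intro card_mono) auto
    also have "\<dots> \<le> 3" by (simp add: card_insert_if)
    finally show False using big by simp
  qed
  show ?thesis
  proof (cases "y \<sim> w")
    case True
    obtain l where l: "l \<in> pverts T" "l \<notin> {x, y, w}" using \<open>\<exists>l \<in> _. _\<close> by blast
    have noty: "\<not> y \<sim> u" if "u \<in> pverts T" "u \<notin> {x, y, w}" for u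
      using no_triangle[OF True wadj[OF that]] .
    have False if m: "m \<in> pverts T" "m \<notin> {x, y, w, l}" for m
    proof -
      obtain u where u: "dominating_set T {l, u}" using R l by auto
      \<comment> \<open>The partner of \<open>l\<close> has to dominate the leaf \<open>x\<close>,
        to which \<open>l\<close> is not adjacent. It also has to dominate \<open>m\<close>, but
        neither \<open>x\<close> nor \<open>y\<close> does.\<close>
      have "u = x \<or> u = y"
        using u xy l leaf' by (auto simp: dominating_set_pair_iff)
      moreover have "u = m \<or> u \<sim> m"
        using u m l indep by (auto simp: dominating_set_pair_iff)
      ultimately show False using m noty leaf by blast
    qed
    then have V: "pverts T = {x, y, w, l}" using all l by blast
    have "path_graph T"
      using V xy wx wy l True leaf noty wadj adjacent_sym
      by (intro path_graphI[of "[x, y, w, l]"]) (auto simp: less_Suc_eq)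
    then show ?thesis using V card4 l by simp
  next
    case False
    have "{x, y} \<noteq> pverts T" using wV wx wy by auto
    \<comment> \<open>An edge leaving \<open>{x, y}\<close> must start at \<open>y\<close>, and in
      this case it does not end in \<open>w\<close>.\<close>
    then obtain v z where "v \<in> {x, y}" "z \<in> pverts T" "z \<notin> {x, y}" "v \<sim> z"
      using ex_adjacent_across[of "{x, y}"] xy by auto
    then have z: "z \<in> pverts T" "z \<notin> {x, y, w}" "y \<sim> z" using leaf False by auto
    \<comment> \<open>Both \<open>u\<close> and \<open>z\<close> are common neighbours of
      \<open>y\<close> and \<open>w\<close>; distinct ones would give a 4-cycle.\<close>
    have uniq: "u = z" if "u \<in> pverts T" "u \<notin> {x, y, w}" "y \<sim> u" for u
      using no_square[of y u w z] that z wadj adjacent_sym wy by blast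
    have False if m: "m \<in> pverts T" "m \<notin> {x, y, w, z}" for m
    proof -
      obtain u where u: "dominating_set T {z, u}" using R z by auto
      have "u = x \<or> u = y"
        using u xy z leaf' by (auto simp: dominating_set_pair_iff)
      moreover have "u = m \<or> u \<sim> m"
        using u m z indep by (auto simp: dominating_set_pair_iff)
      ultimately show False using m uniq leaf by blast
    qed
    then have V: "pverts T = {x, y, w, z}" using all z by blast
    have "path_graph T"
      using V xy wx wy z False leaf wadj adjacent_sym
      by (intro path_graphI[of "[x, y, z, w]"]) (auto simp: less_Suc_eq)
    then show ?thesis using V card4 z by simp
  qed
qed

section \<open>Coalitions in paths of order at most four\<close>

text \<open>In orders 1 and 2 every vertex dominates. In order 3 the middle vertex dominates and the
  ends are partners. In order 4 the two ends are partners, and so are the two inner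
  vertices.\<close>

lemma path_graph_imp_coalitions:
  assumes "path_graph T" "card (pverts T) \<le> 4" "v \<in> pverts T"
  shows "dominating_set T {v} \<or> (\<exists>w \<in> pverts T. coalition T {v} {w})"
proof -
  \<comment> \<open>With the bound written as \<open>i < length vs - 1\<close>, an explicit list
    turns the existential into a finite disjunction over its edges.\<close>
  obtain vs where vs: "vs \<noteq> []" "distinct vs" "pverts T = set vs"
    and adj: "\<And>x y. x \<sim> y \<longleftrightarrow> (\<exists>i < length vs - 1. {x, y} = {vs ! i, vs ! Suc i})"
    using assms(1) unfolding path_graph_def less_diff_conv by force
  have "length vs \<le> 4" using assms(2) vs distinct_card[of vs] by simp
  then consider a where "vs = [a]" | a b where "vs = [a, b]" | a b c where "vs = [a, b, c]"
    | a b c d where "vs = [a, b, c, d]"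
    using vs(1) by (auto simp: neq_Nil_conv Suc_le_eq le_Suc_eq numeral_eq_Suc length_Suc_conv)
  then show ?thesis
  proof cases
    case 1
    then show ?thesis using vs assms(3) by (auto simp: dominating_set_singleton_iff)
  next
    case 2
    then show ?thesis
      using vs assms(3) adj by (auto simp: dominating_set_singleton_iff)
  next
    case 3
    have "x \<sim> y \<longleftrightarrow> {x, y} = {a, b} \<or> {x, y} = {b, c}" for x y
      unfolding adj 3 by (simp add: numeral_2_eq_2 less_Suc_eq ex_disj_distrib conj_disj_distribR)
    then have A: "x \<sim> y \<longleftrightarrow> (x = a \<and> y = b \<or> x = b \<and> y = a) \<or> (x = b \<and> y = c \<or> x = c \<and> y = b)" for x y
      by (simp add: doubleton_eq_iff)
    have V: "pverts T = {a, b, c}" and d: "distinct [a, b, c]" using vs 3 by auto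
    have "dominating_set T {b}" "coalition T {a} {c}"
      using d by (auto simp: A V dominating_set_singleton_iff dominating_set_pair_iff
          coalition_singletons_iff)
    then show ?thesis using assms(3) coalition_sym unfolding V by blast
  next
    case 4
    have "x \<sim> y \<longleftrightarrow> {x, y} = {a, b} \<or> {x, y} = {b, c} \<or> {x, y} = {c, d}" for x y
      unfolding adj 4 by (simp add: numeral_3_eq_3 less_Suc_eq ex_disj_distrib conj_disj_distribR)
    then have A: "x \<sim> y \<longleftrightarrow> (x = a \<and> y = b \<or> x = b \<and> y = a) \<or>
        (x = b \<and> y = c \<or> x = c \<and> y = b) \<or> (x = c \<and> y = d \<or> x = d \<and> y = c)" for x y
      by (simp add: doubleton_eq_iff)
    have V: "pverts T = {a, b, c, d}" and d: "distinct [a, b, c, d]" using vs 4 by auto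
    have "coalition T {a} {d}" "coalition T {b} {c}"
      using d by (auto simp: A V dominating_set_singleton_iff dominating_set_pair_iff
          coalition_singletons_iff)
    then show ?thesis using assms(3) coalition_sym unfolding V by blast
  qed
qed

end

lemma undirected_tree_imp_locale:
  "undirected_tree T \<Longrightarrow> undirected_tree_graph T"
  by (simp add: undirected_tree_def undirected_tree_graph_def undirected_tree_graph_axioms_def)

theorem theorem7:
  fixes T :: "'a pair_pre_digraph" and n :: nat
  assumes "undirected_tree T" and "n = card (pverts T)"
  shows "coalition_number T = n \<longleftrightarrow> path_graph T \<and> n \<le> 4"
proof -
  interpret undirected_tree_graph T using assms(1) by (rule undirected_tree_imp_locale)
  let ?R = "\<forall>v \<in> pverts T. dominating_set T {v} \<or> (\<exists>w \<in> pverts T. coalition T {v} {w})"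
  have "path_graph T \<and> card (pverts T) \<le> 4" if R: ?R
  proof (cases "card (pverts T) \<le> 3")
    case True
    then show ?thesis using card_le_3_imp_path_graph by simp
  next
    case False
    then have nodom: "\<forall>v. \<not> dominating_set T {v}"
      using dominating_vertex_imp_card_le_3 R by blast
    then have "\<forall>v \<in> pverts T. \<exists>w. dominating_set T {v, w}"
      using R unfolding coalition_singletons_iff by blast
    then show ?thesis using all_coalitions_imp_path_graph nodom False by simp
  qed
  then have "?R \<longleftrightarrow> path_graph T \<and> card (pverts T) \<le> 4"
    using path_graph_imp_coalitions by blast
  then show ?thesis
    using coalition_number_eq_card_iff[of T] verts_nonempty finite_verts assms(2) by simp
qed

end
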